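(* Let $k\ge3$, $a>0$ and $D\ge1$, and suppose that for each $n$, $\mathcal{H}=\mathcal{H}_n$ is a $k$-uniform hypergraph satisfying $v(\mathcal{H})\le Dn$, $e(\mathcal{H})\ge an^2$ and $\Delta_2(\mathcal{H})\le D$. Let $X=e(\mathcal{H}_p)$, $\mu=\mathbb{E}X$ and $\varphi(x)=(1+x)\log(1+x)-x$. There are $n_0,c,d>0$ (depending only on $k,a,D$) such that for all $n\ge n_0$, $0<p\le n^{-2/(k+1/3)}$ and $t\ge0$ satisfying $1\le\mu+t\le9\max\{\mu,n^{1/(2k)}\}$ we have \[ \Pr(X\ge\mu+t)\ge d\exp\bigl(-c\varphi(t/\mu)\mu\bigr)\ge d\exp\bigl(-ct^2/\mu\bigr). \]
   Context: $V_p(\mathcal{H})$ is the random subset of $V(\mathcal{H})$ containing each vertex independently with probability $p$, and $\mathcal{H}_p=\mathcal{H}[V_p(\mathcal{H})]$. $\Delta_2(\mathcal{H})$ is the maximum number of edges containing a given pair of vertices. *)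

theory Defs
  imports "HOL-Probability.Probability"
begin

record 'a hypergraph =
  hverts :: "'a set"
  hedges :: "'a set set"

definition uniform_hypergraph :: "nat \<Rightarrow> 'a hypergraph \<Rightarrow> bool" where
  "uniform_hypergraph k H \<longleftrightarrow>
     finite (hverts H) \<and> (\<forall>e\<in>hedges H. e \<subseteq> hverts H \<and> card e = k)"

definition num_verts :: "'a hypergraph \<Rightarrow> nat" where
  "num_verts H = card (hverts H)"

definition num_edges :: "'a hypergraph \<Rightarrow> nat" where
  "num_edges H = card (hedges H)"

text \<open>A pair means two distinct vertices. The inserted \<open>0\<close> only matters when there are
  fewer than two vertices, where the maximum would otherwise be over the empty set.\<close>

definition Delta2 :: "'a hypergraph \<Rightarrow> nat" where
  "Delta2 H = Max (insert 0
     {card {e \<in> hedges H. u \<in> e \<and> v \<in> e} | u v.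
        u \<in> hverts H \<and> v \<in> hverts H \<and> u \<noteq> v})"

definition induced :: "'a hypergraph \<Rightarrow> 'a set \<Rightarrow> 'a hypergraph" where
  "induced H W = \<lparr>hverts = hverts H \<inter> W, hedges = {e \<in> hedges H. e \<subseteq> W}\<rparr>"

text \<open>The law of the random vertex set \<open>V\<^sub>p(H)\<close>: one independent Bernoulli(\<open>p\<close>) indicator
  per vertex. It is meaningful for finite \<open>hverts H\<close> and \<open>0 \<le> p \<le> 1\<close>.\<close>

definition random_verts :: "'a hypergraph \<Rightarrow> real \<Rightarrow> 'a set pmf" where
  "random_verts H p =
     map_pmf (\<lambda>f. {v \<in> hverts H. f v}) (Pi_pmf (hverts H) False (\<lambda>_. bernoulli_pmf p))"

definition random_induced :: "'a hypergraph \<Rightarrow> real \<Rightarrow> 'a hypergraph pmf" where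
  "random_induced H p = map_pmf (induced H) (random_verts H p)"

definition mean_edges :: "'a hypergraph \<Rightarrow> real \<Rightarrow> real" where
  "mean_edges H p = measure_pmf.expectation (random_induced H p) (\<lambda>G. real (num_edges G))"

definition phi :: "real \<Rightarrow> real" where
  "phi x = (1 + x) * ln (1 + x) - x"

end

theory Submission
  imports Defs
begin

text \<open>
  Only the case where the edges of \<open>H\<^sub>p\<close> form an induced matching \<open>S\<close> of prescribed size
  \<open>m\<close> matters. Choosing edges greedily there are at least \<open>(e(H) - O(m\<^sup>2 n))\<^sup>m / m!\<close> such
  \<open>S\<close>, because every vertex has degree \<open>O(n)\<close> and every pair has bounded codegree. Given that
  \<open>S\<close> is present, Harris' inequality bounds the probability that no other edge is present below by
  the product of the individual probabilities. Edges disjoint from \<open>\<Union>S\<close> contribute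
  \<open>exp (-\<mu>)\<close>, and since \<open>m n p\<^bsup>k-1\<^esup>\<close> and \<open>m\<^sup>2 p\<close> are bounded all others together contribute
  a constant. Hence \<open>Pr (X = m)\<close> is at least a constant times the Poisson(\<open>\<mu>\<close>) mass at \<open>m\<close>,
  uniformly over the relevant range of \<open>m\<close>. With \<open>s = \<mu> + t\<close>, summing over
  \<open>s \<le> m \<le> s + sqrt s\<close> compensates the factor \<open>1 / sqrt m\<close> in Stirling's formula, while
  \<open>\<phi>\<close> changes by at most a constant factor plus \<open>O(1/\<mu>)\<close>.
\<close>

subsection \<open>The function \<open>phi\<close> and Poisson upper tails\<close>

text \<open>Stirling's upper bound \<open>m! <= e * sqrt m * (m / e) ^ m\<close> in logarithmic
  form. The induction step amounts to \<open>(m + 1/2) * ln (1 + 1/m) >= 1\<close>.\<close>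

lemma ln_fact_le:
  assumes "m \<ge> 1"
  shows "ln (fact m) \<le> 1 + ln (real m) / 2 + real m * ln (real m) - real m"
  using assms
proof (induction m rule: dec_induct)
  case base
  then show ?case by simp
next
  case (step m)
  have m: "real m > 0" using step by simp
  have "2 * ((real m + 1) - real m) / (real m + (real m + 1)) \<le> ln (real m + 1) - ln (real m)"
    using m by (intro ln_inverse_approx_ge) auto
  then have "1 \<le> (real m + 1/2) * (ln (real m + 1) - ln (real m))"
    using m by (simp add: field_simps)
  then have "ln (real m + 1) + (1 + ln (real m) / 2 + real m * ln (real m) - real m)
      \<le> 1 + ln (real m + 1) / 2 + (real m + 1) * ln (real m + 1) - (real m + 1)"
    by (simp add: algebra_simps)
  moreover have "ln (fact (Suc m) :: real) = ln (real m + 1) + ln (fact m)"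
    using m by (simp add: ln_mult add.commute)
  ultimately show ?case using step.IH by (simp add: add.commute)
qed

lemma phi_has_derivative:
  assumes "x \<ge> 0"
  shows "(phi has_real_derivative ln (1 + x)) (at x)"
  unfolding phi_def using assms by (auto intro!: derivative_eq_intros)

lemma phi_mono:
  assumes "0 \<le> x" "x \<le> y"
  shows "phi x \<le> phi y"
  using assms(2)
proof (rule DERIV_nonneg_imp_nondecreasing)
  fix z assume "x \<le> z" "z \<le> y"
  then show "\<exists>d. (phi has_real_derivative d) (at z) \<and> 0 \<le> d"
    using assms by (intro exI[of _ "ln (1 + z)"] conjI phi_has_derivative) auto
qed

lemma phi_nonneg: "0 \<le> x \<Longrightarrow> 0 \<le> phi x"
  using phi_mono[of 0 x] by (simp add: phi_def)

lemma phi_le_square: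
  assumes "0 \<le> x"
  shows "phi x \<le> x\<^sup>2"
proof -
  have "(1 + x) * ln (1 + x) \<le> (1 + x) * x"
    using assms by (intro mult_left_mono ln_add_one_self_le_self) auto
  then show ?thesis by (simp add: phi_def power2_eq_square algebra_simps)
qed

text \<open>Comparing derivatives, \<open>9 * ln (1 + z)\<close> against
  \<open>3 * ln (1 + 3 * z)\<close>, leaves Bernoulli's \<open>1 + 3 * z <= (1 + z) ^ 3\<close>.
  Tripling a deviation thus costs only a factor 9 in the exponent; this is the source of the final
  constant \<open>c = 9\<close>.\<close>

lemma phi_triple_le:
  assumes "0 \<le> x"
  shows "phi (3 * x) \<le> 9 * phi x"
proof -
  let ?g = "\<lambda>z. 9 * phi z - phi (3 * z)"
  have "?g 0 \<le> ?g x"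
    using assms
  proof (rule DERIV_nonneg_imp_nondecreasing)
    fix z :: real assume z: "0 \<le> z" "z \<le> x"
    have "1 + 3 * z \<le> (1 + z) ^ 3"
      using z by (simp add: power3_eq_cube algebra_simps)
    then have "ln (1 + 3 * z) \<le> ln ((1 + z) ^ 3)"
      using z by simp
    then have "9 * ln (1 + z) - ln (1 + 3 * z) * 3 \<ge> 0"
      using z by (simp add: ln_realpow)
    moreover have "(?g has_real_derivative 9 * ln (1 + z) - ln (1 + 3 * z) * 3) (at z)"
      using z by (auto intro!: derivative_eq_intros phi_has_derivative
          DERIV_chain2[where f = phi and g = "\<lambda>z. 3 * z"])
    ultimately show "\<exists>d. (?g has_real_derivative d) (at z) \<and> 0 \<le> d"
      by blast
  qed
  then show ?thesis by (simp add: phi_def)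
qed

text \<open>With \<open>m = (1 + x) * \<mu>\<close>, the part
  \<open>m - \<mu> + m * ln \<mu> - m * ln m\<close> of the logarithm of the mass is exactly
  \<open>- phi x * \<mu>\<close>. What is left of Stirling's bound is the factor
  \<open>1 / (e * sqrt m)\<close>.\<close>

lemma poisson_mass_ge:
  assumes "\<mu> > 0" "m \<ge> 1"
  shows "exp (- \<mu>) * \<mu> ^ m / fact m
    \<ge> exp (- 1 - phi ((real m - \<mu>) / \<mu>) * \<mu>) / sqrt (real m)"
proof -
  have m: "real m > 0" using assms by simp
  have "phi ((real m - \<mu>) / \<mu>) * \<mu> = real m * ln (real m / \<mu>) - (real m - \<mu>)"
    using assms by (simp add: phi_def field_simps)
  also have "ln (real m / \<mu>) = ln (real m) - ln \<mu>"
    using assms by (simp add: ln_div)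
  finally have phi: "phi ((real m - \<mu>) / \<mu>) * \<mu>
      = real m * (ln (real m) - ln \<mu>) - (real m - \<mu>)" .
  have "exp (- 1 - phi ((real m - \<mu>) / \<mu>) * \<mu>) / sqrt (real m)
      = exp (- 1 - phi ((real m - \<mu>) / \<mu>) * \<mu> - ln (sqrt (real m)))"
    using m by (simp add: exp_diff)
  also have "\<dots> \<le> exp (- \<mu> + real m * ln \<mu> - ln (fact m))"
    using ln_fact_le[OF assms(2)] m phi
    by (simp add: ln_sqrt algebra_simps)
  also have "\<dots> = exp (- \<mu>) * \<mu> ^ m / fact m"
    using assms by (simp add: exp_diff exp_add exp_of_nat_mult exp_minus field_simps)
  finally show ?thesis .
qed

text \<open>Put \<open>s = \<mu> + t\<close>. If \<open>sqrt s <= 2 * t\<close>, the shift at most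
  triples \<open>t\<close>. Otherwise \<open>\<mu> >= s / 2\<close>, and the quadratic bound on
  \<open>phi\<close> leaves only a constant.\<close>

lemma phi_shift_le:
  assumes "\<mu> > 0" "t \<ge> 0" "1 \<le> \<mu> + t"
  shows "phi ((t + sqrt (\<mu> + t)) / \<mu>) * \<mu> \<le> 9 / 2 + 9 * phi (t / \<mu>) * \<mu>"
proof -
  define s where "s = \<mu> + t"
  have s: "s \<ge> 1" using assms by (simp add: s_def)
  have nn: "0 \<le> phi (t / \<mu>) * \<mu>" using assms by (simp add: phi_nonneg)
  show ?thesis
  proof (cases "2 * t \<ge> sqrt s")
    case True
    have "phi ((t + sqrt s) / \<mu>) \<le> phi (3 * (t / \<mu>))"
      using True assms s by (intro phi_mono) (auto simp: field_simps)
    also have "\<dots> \<le> 9 * phi (t / \<mu>)"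
      using assms by (intro phi_triple_le) auto
    finally have "phi ((t + sqrt s) / \<mu>) * \<mu> \<le> 9 * phi (t / \<mu>) * \<mu>"
      using assms by (intro mult_right_mono) auto
    then show ?thesis by (simp add: s_def)
  next
    case False
    have "sqrt s \<le> s"
      using s real_sqrt_le_mono[of s "s\<^sup>2"] by (simp add: power2_eq_square)
    then have \<mu>: "\<mu> \<ge> s / 2" using False by (simp add: s_def)
    have "phi ((t + sqrt s) / \<mu>) \<le> ((t + sqrt s) / \<mu>)\<^sup>2"
      using assms s by (intro phi_le_square) auto
    also have "\<dots> \<le> ((3 / 2) * sqrt s / \<mu>)\<^sup>2"
      using False assms s by (intro power_mono divide_right_mono) auto
    also have "\<dots> = 9 / 4 * s / \<mu>\<^sup>2"
      using s by (simp add: power_divide power_mult_distrib)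
    finally have "phi ((t + sqrt s) / \<mu>) * \<mu> \<le> 9 / 4 * s / \<mu>\<^sup>2 * \<mu>"
      using assms by (intro mult_right_mono) auto
    also have "\<dots> \<le> 9 / 2"
      using \<mu> assms by (simp add: field_simps power2_eq_square)
    finally show ?thesis using nn by (simp add: s_def)
  qed
qed

text \<open>The window of length \<open>sqrt s\<close> holds at least \<open>sqrt s / 2\<close>
  integers, each of mass at least a constant times \<open>1 / sqrt s\<close> times the exponential,
  so the powers of \<open>s\<close> cancel.\<close>

lemma poisson_tail_ge:
  fixes \<mu> t :: real
  defines "N \<equiv> {m::nat. \<mu> + t \<le> real m \<and> real m \<le> \<mu> + t + sqrt (\<mu> + t)}"
  assumes "\<mu> > 0" "t \<ge> 0" "1 \<le> \<mu> + t"
  shows "(\<Sum>m\<in>N. exp (- \<mu>) * \<mu> ^ m / fact m)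
    \<ge> exp (- 11 / 2) / (2 * sqrt 2) * exp (- 9 * phi (t / \<mu>) * \<mu>)"
proof -
  define s where "s = \<mu> + t"
  have s: "s \<ge> 1" using assms by (simp add: s_def)
  have rs: "sqrt s \<ge> 1" "sqrt s \<le> s"
    using s real_sqrt_le_mono[of s "s\<^sup>2"] by (auto simp: power2_eq_square)
  have "N \<subseteq> {..nat \<lceil>s + sqrt s\<rceil>}"
    unfolding N_def s_def by (auto simp del: of_nat_le_iff) linarith
  then have fin: "finite N" by (rule finite_subset) simp
  \<comment> \<open>The half-open block matters: its last element is less than
    \<open>(s + 1) + sqrt s - 1\<close>, so rounding \<open>s\<close> up does not leave the
    window.\<close>
  have "{nat \<lceil>s\<rceil>..<nat \<lceil>s\<rceil> + nat \<lfloor>sqrt s\<rfloor>} \<subseteq> N"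
    unfolding N_def s_def[symmetric] using s rs by auto linarith+
  then have "nat \<lfloor>sqrt s\<rfloor> \<le> card N"
    using card_mono[OF fin, of "{nat \<lceil>s\<rceil>..<nat \<lceil>s\<rceil> + nat \<lfloor>sqrt s\<rfloor>}"] by simp
  moreover have "sqrt s / 2 \<le> real (nat \<lfloor>sqrt s\<rfloor>)"
  proof -
    have "1 \<le> \<lfloor>sqrt s\<rfloor>" using rs by simp
    then have "real (nat \<lfloor>sqrt s\<rfloor>) = of_int \<lfloor>sqrt s\<rfloor>" "1 \<le> real_of_int \<lfloor>sqrt s\<rfloor>"
      by simp_all
    then show ?thesis using floor_correct[of "sqrt s"] by linarith
  qed
  ultimately have cN: "sqrt s / 2 \<le> real (card N)" by linarith
  \<comment> \<open>Here \<open>11 / 2\<close> is 1 from Stirling plus \<open>9 / 2\<close> from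
    \<open>phi_shift_le\<close>, and \<open>sqrt (2 * s)\<close> dominates \<open>sqrt m\<close>
    because \<open>m <= s + sqrt s <= 2 * s\<close>.\<close>
  define b where "b = exp (- 11 / 2 - 9 * phi (t / \<mu>) * \<mu>) / sqrt (2 * s)"
  have "b \<ge> 0" using s by (simp add: b_def)
  have each: "b \<le> exp (- \<mu>) * \<mu> ^ m / fact m" if "m \<in> N" for m
  proof -
    have m: "s \<le> real m" "real m \<le> s + sqrt s" using that by (auto simp: N_def s_def)
    have "phi ((real m - \<mu>) / \<mu>) \<le> phi ((t + sqrt s) / \<mu>)"
      using m assms by (intro phi_mono divide_right_mono divide_nonneg_pos) (auto simp: s_def)
    then have "phi ((real m - \<mu>) / \<mu>) * \<mu> \<le> phi ((t + sqrt s) / \<mu>) * \<mu>"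
      using assms by (intro mult_right_mono) auto
    also have "\<dots> \<le> 9 / 2 + 9 * phi (t / \<mu>) * \<mu>"
      using phi_shift_le[of \<mu> t] assms by (simp add: s_def)
    finally have "b \<le> exp (- 1 - phi ((real m - \<mu>) / \<mu>) * \<mu>) / sqrt (real m)"
      unfolding b_def using m rs s by (intro frac_le) auto
    also have "\<dots> \<le> exp (- \<mu>) * \<mu> ^ m / fact m"
      using m s assms by (intro poisson_mass_ge) auto
    finally show ?thesis .
  qed
  have "exp (- 11 / 2) / (2 * sqrt 2) * exp (- 9 * phi (t / \<mu>) * \<mu>) = sqrt s / 2 * b"
    using s by (simp add: b_def real_sqrt_mult exp_diff exp_minus) (simp add: field_simps)
  also have "\<dots> \<le> real (card N) * b"
    using cN \<open>b \<ge> 0\<close> by (rule mult_right_mono)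
  also have "\<dots> \<le> (\<Sum>m\<in>N. exp (- \<mu>) * \<mu> ^ m / fact m)"
    using sum_bounded_below[of N b] each by simp
  finally show ?thesis .
qed

subsection \<open>Random subsets and the Harris inequality\<close>

text \<open>Expectation over a \<open>p\<close>-random subset of \<open>V\<close>, written as a
  finite sum so that the ground set is a parameter: it can be inducted on, and a planted set can be
  removed from it.\<close>

definition subset_expectation :: "'a set \<Rightarrow> real \<Rightarrow> ('a set \<Rightarrow> real) \<Rightarrow> real" where
  "subset_expectation V p f =
     (\<Sum>W\<in>Pow V. p ^ card W * (1 - p) ^ card (V - W) * f W)"

lemma pmf_random_verts:
  assumes fin: "finite (hverts H)" and p: "0 \<le> p" "p \<le> 1" and W: "W \<subseteq> hverts H"
  shows "pmf (random_verts H p) W = p ^ card W * (1 - p) ^ card (hverts H - W)"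
proof -
  let ?V = "hverts H" and ?M = "Pi_pmf (hverts H) False (\<lambda>_. bernoulli_pmf p)"
  have "pmf (random_verts H p) W = measure_pmf.prob ?M ((\<lambda>f. {v \<in> ?V. f v}) -` {W})"
    by (simp add: random_verts_def pmf_map)
  also have "\<dots> = measure_pmf.prob ?M {\<lambda>v. v \<in> W}"
  proof (rule measure_pmf.finite_measure_eq_AE)
    \<comment> \<open>Functions in the support take the default \<open>False\<close> outside
      \<open>?V\<close>, so almost surely a function is determined by its true points in
      \<open>?V\<close>.\<close>
    show "AE f in measure_pmf ?M. f \<in> (\<lambda>f. {v \<in> ?V. f v}) -` {W} \<longleftrightarrow> f \<in> {\<lambda>v. v \<in> W}"
      using set_Pi_pmf_subset[OF fin, of False "\<lambda>_. bernoulli_pmf p"] W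
      by (auto simp: AE_measure_pmf_iff fun_eq_iff)
  qed auto
  also have "\<dots> = pmf ?M (\<lambda>v. v \<in> W)"
    by (simp add: pmf.rep_eq)
  also have "\<dots> = (\<Prod>v\<in>?V. pmf (bernoulli_pmf p) (v \<in> W))"
    using W by (intro pmf_Pi' fin) auto
  also have "\<dots> = (\<Prod>v\<in>?V. if v \<in> W then p else 1 - p)"
    using p by (intro prod.cong) auto
  also have "\<dots> = p ^ card W * (1 - p) ^ card (?V - W)"
    using W fin by (simp add: prod.If_cases Int_absorb1 Diff_eq)
  finally show ?thesis .
qed

lemma expectation_random_verts:
  assumes fin: "finite (hverts H)" and p: "0 \<le> p" "p \<le> 1"
  shows "measure_pmf.expectation (random_verts H p) f = subset_expectation (hverts H) p f"
proof -
  have "set_pmf (random_verts H p) \<subseteq> Pow (hverts H)"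
    by (auto simp: random_verts_def)
  then have "measure_pmf.expectation (random_verts H p) f
      = (\<Sum>W\<in>Pow (hverts H). f W * pmf (random_verts H p) W)"
    using fin by (intro integral_measure_pmf_real) auto
  then show ?thesis
    using assms by (simp add: subset_expectation_def pmf_random_verts mult.commute)
qed

lemma subset_expectation_cong:
  assumes "\<And>W. W \<subseteq> V \<Longrightarrow> f W = g W"
  shows "subset_expectation V p f = subset_expectation V p g"
  unfolding subset_expectation_def by (intro sum.cong) (auto simp: assms)

lemma subset_expectation_mono:
  assumes "0 \<le> p" "p \<le> 1" "\<And>W. W \<subseteq> V \<Longrightarrow> f W \<le> g W"
  shows "subset_expectation V p f \<le> subset_expectation V p g"
  unfolding subset_expectation_def using assms by (intro sum_mono mult_left_mono) auto

lemma subset_expectation_sum: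
  "subset_expectation V p (\<lambda>W. \<Sum>i\<in>I. f i W) = (\<Sum>i\<in>I. subset_expectation V p (f i))"
  unfolding subset_expectation_def by (subst sum.swap) (simp add: sum_distrib_left)

lemma subset_expectation_add:
  "subset_expectation V p (\<lambda>W. f W + g W) = subset_expectation V p f + subset_expectation V p g"
  unfolding subset_expectation_def by (simp add: distrib_left sum.distrib)

lemma subset_expectation_zero [simp]: "subset_expectation V p (\<lambda>_. 0) = 0"
  by (simp add: subset_expectation_def)

text \<open>Conditioning on whether \<open>x\<close> is selected; this recursion drives the
  inductions on the ground set.\<close>

lemma subset_expectation_insert:
  assumes "finite V" "x \<notin> V"
  shows "subset_expectation (insert x V) p f =
    p * subset_expectation V p (\<lambda>W. f (insert x W)) + (1 - p) * subset_expectation V p f"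
proof -
  let ?w = "\<lambda>W. p ^ card W * (1 - p) ^ card (insert x V - W) * f W"
  have "Pow V \<inter> insert x ` Pow V = {}" using assms by auto
  then have "subset_expectation (insert x V) p f = sum ?w (Pow V) + sum ?w (insert x ` Pow V)"
    unfolding subset_expectation_def Pow_insert using assms by (intro sum.union_disjoint) auto
  also have "sum ?w (insert x ` Pow V) = (\<Sum>W\<in>Pow V. ?w (insert x W))"
    using assms by (intro sum.reindex_cong[of "insert x"]) (auto simp: inj_on_def)
  also have "\<dots> = p * subset_expectation V p (\<lambda>W. f (insert x W))"
    unfolding subset_expectation_def sum_distrib_left
  proof (intro sum.cong refl)
    fix W assume "W \<in> Pow V"
    moreover from this have "finite W" "x \<notin> W" "insert x V - insert x W = V - W"
      using assms by (auto intro: finite_subset)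
    ultimately show "?w (insert x W) = p * (p ^ card W * (1 - p) ^ card (V - W) * f (insert x W))"
      by (simp add: algebra_simps)
  qed
  also have "sum ?w (Pow V) = (1 - p) * subset_expectation V p f"
    unfolding subset_expectation_def sum_distrib_left
  proof (intro sum.cong refl)
    fix W assume "W \<in> Pow V"
    then have "insert x V - W = insert x (V - W)" "x \<notin> V - W" "finite (V - W)"
      using assms by auto
    then show "?w W = (1 - p) * (p ^ card W * (1 - p) ^ card (V - W) * f W)"
      by (simp add: algebra_simps)
  qed
  finally show ?thesis by simp
qed

lemma subset_expectation_const [simp]:
  "finite V \<Longrightarrow> subset_expectation V p (\<lambda>_. c) = c"
proof (induction V rule: finite_induct)
  case empty
  then show ?case by (simp add: subset_expectation_def)
next
  case (insert x V)
  then show ?case by (simp add: subset_expectation_insert algebra_simps)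
qed

text \<open>Given that \<open>U\<close> is selected, the rest of the random set is a
  \<open>p\<close>-random subset of \<open>V - U\<close>. Vertices of \<open>U\<close> are exposed
  one at a time, so \<open>V\<close> and \<open>g\<close> vary in the induction.\<close>

lemma subset_expectation_superset:
  assumes "finite V" "U \<subseteq> V"
  shows "subset_expectation V p (\<lambda>W. of_bool (U \<subseteq> W) * g W) =
    p ^ card U * subset_expectation (V - U) p (\<lambda>W. g (U \<union> W))"
proof -
  have "finite U" using assms finite_subset by blast
  then show ?thesis using assms
  proof (induction U arbitrary: V g rule: finite_induct)
    case empty
    then show ?case by simp
  next
    case (insert x U)
    let ?V = "V - {x}"
    have V: "V = insert x ?V" "finite ?V" "x \<notin> ?V" "U \<subseteq> ?V" using insert by auto
    have "subset_expectation V p (\<lambda>W. of_bool (insert x U \<subseteq> W) * g W) =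
        p * subset_expectation ?V p (\<lambda>W. of_bool (insert x U \<subseteq> insert x W) * g (insert x W))
        + (1 - p) * subset_expectation ?V p (\<lambda>W. of_bool (insert x U \<subseteq> W) * g W)"
      by (subst V(1)) (rule subset_expectation_insert[OF V(2,3)])
    also have "subset_expectation ?V p (\<lambda>W. of_bool (insert x U \<subseteq> W) * g W)
        = subset_expectation ?V p (\<lambda>_. 0)"
      by (rule subset_expectation_cong) auto
    also have "subset_expectation ?V p (\<lambda>W. of_bool (insert x U \<subseteq> insert x W) * g (insert x W))
        = subset_expectation ?V p (\<lambda>W. of_bool (U \<subseteq> W) * g (insert x W))"
      using insert by (intro subset_expectation_cong) auto
    also have "\<dots> = p ^ card U * subset_expectation (?V - U) p (\<lambda>W. g (insert x (U \<union> W)))"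
      using V by (intro insert.IH)
    also have "?V - U = V - insert x U" by auto
    finally show ?case using insert by simp
  qed
qed

lemma subset_expectation_of_bool_superset:
  assumes "finite V" "U \<subseteq> V"
  shows "subset_expectation V p (\<lambda>W. of_bool (U \<subseteq> W)) = p ^ card U"
  using subset_expectation_superset[of V U p "\<lambda>_. 1"] assms by simp

text \<open>Induction on the ground set: the induction hypothesis handles both cases for the new
  vertex \<open>x\<close>, and Chebyshev's inequality on two points combines them, since both
  conditional expectations drop when \<open>x\<close> is present.\<close>

lemma harris_inequality:
  fixes f g :: "'a set \<Rightarrow> real"
  assumes "finite V" "0 \<le> p" "p \<le> 1" "antimono f" "antimono g"
  shows "subset_expectation V p f * subset_expectation V p g
    \<le> subset_expectation V p (\<lambda>W. f W * g W)"
  using assms(1,4,5)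
proof (induction V arbitrary: f g rule: finite_induct)
  case empty
  then show ?case by (simp add: subset_expectation_def)
next
  case (insert x V)
  let ?E = "subset_expectation V p"
  let ?f = "\<lambda>W. f (insert x W)" and ?g = "\<lambda>W. g (insert x W)"
  have am: "antimono ?f" "antimono ?g"
    using insert.prems by (auto intro!: antimonoI elim!: antimonoD)
  have f: "?E ?f \<le> ?E f"
    using assms by (intro subset_expectation_mono antimonoD[OF insert.prems(1)]) auto
  have g: "?E ?g \<le> ?E g"
    using assms by (intro subset_expectation_mono antimonoD[OF insert.prems(2)]) auto
  \<comment> \<open>This product is exactly the right side minus the left side of the next
    inequality.\<close>
  have "0 \<le> p * (1 - p) * ((?E f - ?E ?f) * (?E g - ?E ?g))"
    using f g assms by (intro mult_nonneg_nonneg) auto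
  then have "(p * ?E ?f + (1 - p) * ?E f) * (p * ?E ?g + (1 - p) * ?E g)
      \<le> p * (?E ?f * ?E ?g) + (1 - p) * (?E f * ?E g)"
    by (simp add: algebra_simps)
  also have "\<dots> \<le> p * ?E (\<lambda>W. ?f W * ?g W) + (1 - p) * ?E (\<lambda>W. f W * g W)"
    using insert.IH[OF am] insert.IH[OF insert.prems] assms
    by (intro add_mono mult_left_mono) auto
  finally show ?case
    using insert by (simp add: subset_expectation_insert)
qed

text \<open>Not containing a given set is a decreasing event, so Harris' inequality applies once per
  index even when the sets \<open>A i\<close> overlap.\<close>

lemma subset_expectation_avoid_ge:
  assumes "finite V" "0 \<le> p" "p \<le> 1" "finite I" "\<And>i. i \<in> I \<Longrightarrow> A i \<subseteq> V"
  shows "(\<Prod>i\<in>I. 1 - p ^ card (A i))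
    \<le> subset_expectation V p (\<lambda>W. of_bool (\<forall>i\<in>I. \<not> A i \<subseteq> W))"
  using assms(4,5)
proof (induction I rule: finite_induct)
  case empty
  then show ?case using assms by simp
next
  case (insert i I)
  let ?E = "subset_expectation V p"
  let ?f = "\<lambda>W. of_bool (\<not> A i \<subseteq> W) :: real" and ?g = "\<lambda>W. of_bool (\<forall>i\<in>I. \<not> A i \<subseteq> W) :: real"
  have "1 = ?E (\<lambda>W. of_bool (A i \<subseteq> W) + ?f W)"
    using assms by (subst subset_expectation_cong[of V _ "\<lambda>_. 1"]) auto
  also have "\<dots> = p ^ card (A i) + ?E ?f"
    using insert assms by (simp add: subset_expectation_add subset_expectation_of_bool_superset)
  finally have Ef: "?E ?f = 1 - p ^ card (A i)" by simp
  have "(\<Prod>i\<in>insert i I. 1 - p ^ card (A i)) \<le> ?E ?f * ?E ?g"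
    using insert assms Ef by (auto intro!: mult_left_mono simp: power_le_one)
  also have "\<dots> \<le> ?E (\<lambda>W. ?f W * ?g W)"
    using assms by (intro harris_inequality antimonoI) (simp_all, blast+)
  also have "\<dots> = ?E (\<lambda>W. of_bool (\<forall>i\<in>insert i I. \<not> A i \<subseteq> W))"
    by (intro subset_expectation_cong) auto
  finally show ?case .
qed

subsection \<open>Induced matchings in hypergraphs of bounded codegree\<close>

lemma card_UN_le_mult:
  assumes "finite I" "\<And>i. i \<in> I \<Longrightarrow> real (card (A i)) \<le> b"
  shows "real (card (\<Union>i\<in>I. A i)) \<le> real (card I) * b"
proof -
  have "real (card (\<Union>i\<in>I. A i)) \<le> (\<Sum>i\<in>I. real (card (A i)))"
    using card_UN_le[OF assms(1), of A] by (simp flip: of_nat_sum)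
  also have "\<dots> \<le> real (card I) * b"
    using assms(2) by (rule sum_bounded_above)
  finally show ?thesis .
qed

lemma two_le_cardE:
  assumes "2 \<le> card A"
  obtains x y where "x \<in> A" "y \<in> A" "x \<noteq> y"
proof -
  have "finite A" using assms by (metis card.infinite not_numeral_le_zero)
  then have "\<not> (\<forall>x\<in>A. \<forall>y\<in>A. x = y)"
    using assms card_le_Suc0_iff_eq[of A] by simp
  then show ?thesis using that by blast
qed

locale sparse_hypergraph =
  fixes V :: "'a set" and E :: "'a set set" and k :: nat and b d :: real
  assumes finite_verts: "finite V"
    and edge_subset: "e \<in> E \<Longrightarrow> e \<subseteq> V"
    and card_edge: "e \<in> E \<Longrightarrow> card e = k"
    and k_ge_3: "3 \<le> k"
    and codegree_le: "\<lbrakk>u \<in> V; v \<in> V; u \<noteq> v\<rbrakk> \<Longrightarrow> real (card {e \<in> E. u \<in> e \<and> v \<in> e}) \<le> b"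
    and degree_le: "u \<in> V \<Longrightarrow> real (card {e \<in> E. u \<in> e}) \<le> d"
    and b_nonneg: "0 \<le> b" and d_nonneg: "0 \<le> d"
begin

lemma finite_edges: "finite E"
  using finite_verts edge_subset by (auto intro: finite_subset[of E "Pow V"])

lemma finite_edge: "e \<in> E \<Longrightarrow> finite e"
  using finite_verts edge_subset finite_subset by blast

lemma card_edges_meeting_le:
  assumes "U \<subseteq> V"
  shows "real (card {e \<in> E. e \<inter> U \<noteq> {}}) \<le> real (card U) * d"
proof -
  have "{e \<in> E. e \<inter> U \<noteq> {}} = (\<Union>u\<in>U. {e \<in> E. u \<in> e})" by auto
  moreover have "finite U" using assms finite_verts by (rule finite_subset)
  then have "real (card (\<Union>u\<in>U. {e \<in> E. u \<in> e})) \<le> real (card U) * d"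
    using assms by (intro card_UN_le_mult) (auto intro: degree_le)
  ultimately show ?thesis by simp
qed

text \<open>Such an edge contains one of at most \<open>(card U)\<^sup>2\<close> ordered pairs of
  distinct vertices of \<open>U\<close>, each of codegree at most \<open>b\<close>. The degree bound
  \<open>d\<close> does not enter, which keeps this count independent of \<open>n\<close>
  later.\<close>

lemma card_edges_meeting_twice_le:
  assumes "U \<subseteq> V"
  shows "real (card {e \<in> E. 2 \<le> card (e \<inter> U)}) \<le> (real (card U))\<^sup>2 * b"
proof -
  let ?P = "{(u, v). u \<in> U \<and> v \<in> U \<and> u \<noteq> v}"
  let ?A = "\<lambda>(u, v). {e \<in> E. u \<in> e \<and> v \<in> e}"
  have U: "finite U" using assms finite_verts finite_subset by blast
  have P: "?P \<subseteq> U \<times> U" by auto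
  then have finP: "finite ?P" using U finite_subset by blast
  have "card ?P \<le> (card U)\<^sup>2"
    using card_mono[OF _ P] U by (simp add: card_cartesian_product power2_eq_square)
  then have "real (card ?P) \<le> real ((card U)\<^sup>2)" by (rule of_nat_mono)
  then have cP: "real (card ?P) \<le> (real (card U))\<^sup>2" by (simp only: of_nat_power)
  have "{e \<in> E. 2 \<le> card (e \<inter> U)} \<subseteq> (\<Union>q\<in>?P. ?A q)"
  proof
    fix e assume e: "e \<in> {e \<in> E. 2 \<le> card (e \<inter> U)}"
    then have "2 \<le> card (e \<inter> U)" by simp
    then obtain x y where "x \<in> e \<inter> U" "y \<in> e \<inter> U" "x \<noteq> y" by (rule two_le_cardE)
    then show "e \<in> (\<Union>q\<in>?P. ?A q)" using e by auto
  qed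
  moreover have "finite (\<Union>q\<in>?P. ?A q)"
    by (rule finite_subset[OF _ finite_edges]) auto
  ultimately have "card {e \<in> E. 2 \<le> card (e \<inter> U)} \<le> card (\<Union>q\<in>?P. ?A q)"
    by (rule card_mono[rotated])
  also have "real (card (\<Union>q\<in>?P. ?A q)) \<le> real (card ?P) * b"
    using finP assms by (intro card_UN_le_mult) (auto intro!: codegree_le)
  also have "\<dots> \<le> (real (card U))\<^sup>2 * b"
    using cP b_nonneg by (rule mult_right_mono)
  finally show ?thesis by simp
qed

section \<open>Counting induced matchings of a given size\<close>

text \<open>The last condition says that the presence of all vertices of \<Union>S forces no edge
  outside \<open>S\<close>; without it, \<Union>S could not lie in \<open>W\<close> while the edges
  inside \<open>W\<close> are exactly \<open>S\<close>.\<close>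

definition induced_matchings :: "nat \<Rightarrow> 'a set set set" where
  "induced_matchings m =
     {S. S \<subseteq> E \<and> pairwise disjnt S \<and> card S = m \<and> (\<forall>f\<in>E. f \<subseteq> \<Union>S \<longrightarrow> f \<in> S)}"

lemma finite_induced_matchings: "finite (induced_matchings m)"
  using finite_edges by (auto simp: induced_matchings_def intro: finite_subset[of _ "Pow E"])

lemma induced_matching_Union:
  assumes "S \<in> induced_matchings m"
  shows "\<Union>S \<subseteq> V" "card (\<Union>S) = k * m"
proof -
  have S: "S \<subseteq> E" "pairwise disjnt S" "card S = m"
    using assms by (auto simp: induced_matchings_def)
  show "\<Union>S \<subseteq> V" using S edge_subset by auto
  have "card (\<Union>S) = sum card S"
    using S finite_edge by (intro card_Union_disjoint) auto
  also have "\<dots> = (\<Sum>e\<in>S. k)"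
    using S card_edge by (intro sum.cong) auto
  finally show "card (\<Union>S) = k * m" using S by simp
qed

definition blocked :: "'a set set \<Rightarrow> 'a set set" where
  "blocked S = {e \<in> E. e \<inter> \<Union>S \<noteq> {} \<or> (\<exists>f\<in>E. f \<subseteq> \<Union>S \<union> e \<and> f \<notin> insert e S)}"

lemma insert_induced_matching:
  assumes S: "S \<in> induced_matchings m" and e: "e \<in> E - blocked S"
  shows "insert e S \<in> induced_matchings (Suc m)" "e \<notin> S"
proof -
  have "e \<inter> \<Union>S = {}" and ind: "\<And>f. \<lbrakk>f \<in> E; f \<subseteq> \<Union>S \<union> e\<rbrakk> \<Longrightarrow> f \<in> insert e S"
    using e by (auto simp: blocked_def)
  moreover have "e \<noteq> {}" using card_edge[of e] k_ge_3 e by auto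
  ultimately show "e \<notin> S" by auto
  moreover have "finite S"
    using S by (auto simp: induced_matchings_def intro: finite_subset[OF _ finite_edges])
  moreover have "pairwise disjnt (insert e S)"
    using S \<open>e \<inter> \<Union>S = {}\<close>
    by (auto simp: induced_matchings_def pairwise_insert disjnt_def)
  ultimately show "insert e S \<in> induced_matchings (Suc m)"
    using S e ind by (auto simp: induced_matchings_def Un_commute)
qed

text \<open>The summands count edges meeting \<Union>S, edges meeting some edge that hits \<Union>S
  twice, and edges sharing two vertices with some edge that meets \<Union>S. The argument is real so
  that a real upper bound on the matching size can be inserted.\<close>

definition blocking_bound :: "real \<Rightarrow> real" where
  "blocking_bound x = real k * x * d + real k * ((real k * x)\<^sup>2 * b) * d
    + real k * x * d * ((real k)\<^sup>2 * b)"

lemma blocking_bound_mono: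
  "\<lbrakk>0 \<le> x; x \<le> y\<rbrakk> \<Longrightarrow> blocking_bound x \<le> blocking_bound y"
  unfolding blocking_bound_def using b_nonneg d_nonneg
  by (intro add_mono mult_mono power_mono mult_nonneg_nonneg zero_le_power) auto

text \<open>An edge \<open>f\<close> completed by adding \<open>e\<close> to \<open>S\<close> either meets \<open>\<Union>S\<close> twice, and there
  are few such \<open>f\<close>, or it meets \<open>e\<close> in \<open>k - 1 \<ge> 2\<close> vertices, and there are few such \<open>e\<close> for
  each \<open>f\<close>.\<close>

lemma card_blocked_le:
  assumes "S \<in> induced_matchings m"
  shows "real (card (blocked S)) \<le> blocking_bound m"
proof -
  define U where "U = \<Union>S"
  have UV: "U \<subseteq> V" and cU: "real (card U) = real k * m"
    using induced_matching_Union[OF assms] by (simp_all add: U_def)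
  define F1 where "F1 = {f \<in> E. f \<inter> U \<noteq> {}}"
  define F2 where "F2 = {f \<in> E. 2 \<le> card (f \<inter> U)}"
  define X where "X = {e \<in> E. e \<inter> \<Union>F2 \<noteq> {}}"
  define Y where "Y = (\<Union>f\<in>F1. {e \<in> E. 2 \<le> card (e \<inter> f)})"
  have fin: "finite F1" "finite F2" "finite X" "finite Y"
    using finite_edges by (auto simp: F1_def F2_def X_def Y_def)
  have "blocked S \<subseteq> F1 \<union> X \<union> Y"
  proof
    fix e assume eb: "e \<in> blocked S"
    then have e: "e \<in> E" by (simp add: blocked_def)
    show "e \<in> F1 \<union> X \<union> Y"
    proof (rule ccontr)
      assume "e \<notin> F1 \<union> X \<union> Y"
      then have no: "e \<inter> U = {}" "e \<notin> X" "e \<notin> Y" using e by (auto simp: F1_def)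
      then obtain f where f: "f \<in> E" "f \<subseteq> U \<union> e" "f \<noteq> e" "f \<notin> S"
        using eb by (auto simp: blocked_def U_def)
      have fe: "finite f" "finite e" "card f = k" "card e = k"
        using f e finite_edge card_edge by auto
      have "\<not> f \<subseteq> U" using f assms by (auto simp: induced_matchings_def U_def)
      then obtain x where x: "x \<in> f" "x \<in> e" using f by auto
      have "f \<notin> F2" using no x e by (auto simp: X_def)
      then have "card (f \<inter> U) \<le> 1" using f by (auto simp: F2_def)
      moreover have "f = (f \<inter> U) \<union> (e \<inter> f)" using f by auto
      then have "k \<le> card (f \<inter> U) + card (e \<inter> f)" using fe card_Un_le by metis
      ultimately have "2 \<le> card (e \<inter> f)" using k_ge_3 by linarith
      \<comment> \<open>If \<open>f\<close> met \<open>U\<close>, then \<open>e\<close> would belong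
        to \<open>Y\<close>. So \<open>f\<close> misses \<open>U\<close>, lies inside
        \<open>e\<close>, and equals \<open>e\<close> since both have \<open>k\<close>
        vertices.\<close>
      then have "f \<notin> F1" using no e by (auto simp: Y_def)
      then have "f \<subseteq> e" using f by (auto simp: F1_def)
      then have "f = e" using fe card_subset_eq[of e f] by simp
      then show False using f by simp
    qed
  qed
  then have "card (blocked S) \<le> card (F1 \<union> X \<union> Y)"
    using fin by (intro card_mono) auto
  also have "\<dots> \<le> card F1 + card X + card Y"
    using card_Un_le[of "F1 \<union> X" Y] card_Un_le[of F1 X] by linarith
  finally have total: "real (card (blocked S)) \<le> real (card F1) + real (card X) + real (card Y)"
    by linarith
  have c1: "real (card F1) \<le> real k * m * d"
    using card_edges_meeting_le[OF UV] cU by (simp add: F1_def)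
  have cX: "real (card X) \<le> real k * ((real k * m)\<^sup>2 * b) * d"
  proof -
    have "real (card F2) \<le> (real k * m)\<^sup>2 * b"
      using card_edges_meeting_twice_le[OF UV] cU by (simp add: F2_def)
    moreover have "real (card (\<Union>f\<in>F2. f)) \<le> real (card F2) * real k"
      using fin card_edge by (intro card_UN_le_mult) (auto simp: F2_def)
    ultimately have "real (card (\<Union>F2)) \<le> (real k * m)\<^sup>2 * b * real k"
      using mult_right_mono[of "real (card F2)" "(real k * m)\<^sup>2 * b" "real k"] by simp
    then have "real (card (\<Union>F2)) * d \<le> (real k * m)\<^sup>2 * b * real k * d"
      using d_nonneg by (rule mult_right_mono)
    moreover have "real (card X) \<le> real (card (\<Union>F2)) * d"
      unfolding X_def using edge_subset by (intro card_edges_meeting_le) (auto simp: F2_def)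
    ultimately show ?thesis by (simp add: mult_ac)
  qed
  have cY: "real (card Y) \<le> real k * m * d * ((real k)\<^sup>2 * b)"
  proof -
    have "real (card Y) \<le> real (card F1) * ((real k)\<^sup>2 * b)"
      unfolding Y_def
    proof (rule card_UN_le_mult[OF fin(1)])
      fix f assume "f \<in> F1"
      then have "f \<subseteq> V" "card f = k" using edge_subset card_edge by (auto simp: F1_def)
      then show "real (card {e \<in> E. 2 \<le> card (e \<inter> f)}) \<le> (real k)\<^sup>2 * b"
        using card_edges_meeting_twice_le[of f] by simp
    qed
    also have "\<dots> \<le> real k * m * d * ((real k)\<^sup>2 * b)"
      using c1 b_nonneg by (intro mult_right_mono) auto
    finally show ?thesis .
  qed
  show ?thesis
    unfolding blocking_bound_def by (rule order_trans[OF total add_mono[OF add_mono[OF c1 cX] cY]])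
qed

text \<open>Double counting of pairs: adding an unblocked \<open>e\<close> to \<open>S\<close> gives
  a larger induced matching with a marked edge, and the pair can be recovered from it. Each larger
  matching has \<open>Suc m\<close> possible marks.\<close>

lemma card_induced_matchings_Suc:
  "real (card (induced_matchings m)) * (real (card E) - blocking_bound m)
    \<le> real (Suc m) * real (card (induced_matchings (Suc m)))"
proof -
  let ?P = "SIGMA S:induced_matchings m. E - blocked S"
  let ?Q = "SIGMA T:induced_matchings (Suc m). T"
  have finE: "finite S" if "S \<in> induced_matchings j" for S j
    using that by (auto simp: induced_matchings_def intro: finite_subset[OF _ finite_edges])
  have "inj_on (\<lambda>(S, e). (insert e S, e)) ?P"
  proof (rule inj_onI, clarify)
    fix S e S' assume "S \<in> induced_matchings m" "e \<in> E" "e \<notin> blocked S"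
      "S' \<in> induced_matchings m" "e \<notin> blocked S'" "insert e S = insert e S'"
    moreover from this have "e \<notin> S" "e \<notin> S'"
      using insert_induced_matching(2) by auto
    ultimately show "S = S' \<and> e = e" by (simp add: insert_ident)
  qed
  moreover have "(\<lambda>(S, e). (insert e S, e)) ` ?P \<subseteq> ?Q"
    using insert_induced_matching(1) by auto
  moreover have "finite ?Q" using finite_induced_matchings finE by auto
  ultimately have "card ?P \<le> card ?Q" by (rule card_inj_on_le)
  also have "card ?Q = (\<Sum>T\<in>induced_matchings (Suc m). card T)"
    using finite_induced_matchings finE by (intro card_SigmaI) auto
  also have "\<dots> = (\<Sum>T\<in>induced_matchings (Suc m). Suc m)"
    by (intro sum.cong) (auto simp: induced_matchings_def)
  also have "\<dots> = Suc m * card (induced_matchings (Suc m))" by (simp add: algebra_simps)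
  finally have "card ?P \<le> Suc m * card (induced_matchings (Suc m))" .
  then have "real (card ?P) \<le> real (Suc m * card (induced_matchings (Suc m)))"
    by (rule of_nat_mono)
  then have Q: "real (card ?P) \<le> real (Suc m) * real (card (induced_matchings (Suc m)))"
    by (simp only: of_nat_mult)
  have "real (card (induced_matchings m)) * (real (card E) - blocking_bound m)
      \<le> (\<Sum>S\<in>induced_matchings m. real (card (E - blocked S)))"
  proof (rule sum_bounded_below)
    fix S assume S: "S \<in> induced_matchings m"
    have sub: "blocked S \<subseteq> E" by (auto simp: blocked_def)
    then have "card (E - blocked S) = card E - card (blocked S)" "card (blocked S) \<le> card E"
      using card_Diff_subset[OF finite_subset[OF sub finite_edges] sub] card_mono[OF finite_edges sub]
      by auto
    then show "real (card E) - blocking_bound m \<le> real (card (E - blocked S))"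
      using card_blocked_le[OF S] by (simp add: of_nat_diff)
  qed
  also have "\<dots> = real (card ?P)"
    using finite_induced_matchings finite_edges by (subst card_SigmaI) auto
  also note Q
  finally show ?thesis .
qed

lemma card_induced_matchings_ge:
  assumes "real m \<le> M" "blocking_bound M \<le> card E"
  shows "(real (card E) - blocking_bound M) ^ m / fact m \<le> card (induced_matchings m)"
  using assms(1)
proof (induction m)
  case 0
  \<comment> \<open>An empty edge would lie inside the empty union, so nonemptiness of edges is what
    makes the empty family an induced matching.\<close>
  have "f \<noteq> {}" if "f \<in> E" for f using card_edge[OF that] k_ge_3 by auto
  moreover have "S = {}" if "S \<in> induced_matchings 0" for S
    using that finite_subset[OF _ finite_edges] by (auto simp: induced_matchings_def)
  moreover have "{} \<in> induced_matchings 0"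
    using calculation(1) by (auto simp: induced_matchings_def)
  ultimately have "induced_matchings 0 = {{}}" by blast
  then show ?case by simp
next
  case (Suc m)
  \<comment> \<open>Blocking is bounded by its value at \<open>M\<close> throughout, which gives
    every step the same factor \<open>?r\<close>, nonnegative by assumption.\<close>
  let ?r = "real (card E) - blocking_bound M"
  have "?r ^ Suc m / fact m = ?r ^ m / fact m * ?r" by simp
  also have "\<dots> \<le> real (card (induced_matchings m)) * ?r"
    using Suc assms by (intro mult_right_mono) auto
  also have "\<dots> \<le> real (card (induced_matchings m)) * (real (card E) - blocking_bound m)"
    using Suc.prems by (intro mult_left_mono diff_left_mono blocking_bound_mono) auto
  also have "\<dots> \<le> real (Suc m) * real (card (induced_matchings (Suc m)))"
    by (rule card_induced_matchings_Suc)
  finally have "?r ^ Suc m / fact m / real (Suc m) \<le> real (card (induced_matchings (Suc m)))"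
    by (subst pos_divide_le_eq) (simp_all only: of_nat_0_less_iff zero_less_Suc mult.commute)
  then show ?case by (simp add: mult.commute)
qed

section \<open>From induced matchings to the distribution of the edge count\<close>

text \<open>Once \<Union>S is planted, an edge \<open>f\<close> outside \<open>S\<close> appears
  with probability \<open>p ^ card (f - \<Union>S)\<close>. Harris' inequality multiplies the
  complementary probabilities, and \<open>1 - x >= exp (- x - 2 * x\<^sup>2)\<close> turns the
  product into a sum sorted by how \<open>f\<close> meets \<Union>S.\<close>

lemma prob_edges_eq_ge:
  assumes p: "0 < p" "p \<le> 1/2" and S: "S \<in> induced_matchings m"
  shows "p ^ (k * m) * exp (- (real (card E) * (p ^ k + 2 * p ^ (2 * k))
      + real k * m * d * (2 * p ^ (k - 1)) + (real k * m)\<^sup>2 * b * (2 * p)))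
    \<le> subset_expectation V p (\<lambda>W. of_bool ({f \<in> E. f \<subseteq> W} = S))"
proof -
  define U where "U = \<Union>S"
  have UV: "U \<subseteq> V" and cU: "card U = k * m" "real (card U) = real k * m"
    using induced_matching_Union[OF S] by (simp_all add: U_def)
  have SE: "S \<subseteq> E" and ind: "\<And>f. \<lbrakk>f \<in> E; f \<subseteq> U\<rbrakk> \<Longrightarrow> f \<in> S"
    using S by (auto simp: induced_matchings_def U_def)
  define F1 where "F1 = {f \<in> E. f \<inter> U \<noteq> {}}"
  define F2 where "F2 = {f \<in> E. 2 \<le> card (f \<inter> U)}"
  \<comment> \<open>For \<open>f\<close> disjoint from \<open>U\<close> the value
    \<open>x + 2 * x\<^sup>2\<close> is kept exactly, so that the first-order terms sum to the mean.
    For the other edges the cruder \<open>2 * x\<close> suffices.\<close>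
  define h where "h f = p ^ k + 2 * p ^ (2 * k) + of_bool (f \<in> F1) * (2 * p ^ (k - 1))
    + of_bool (f \<in> F2) * (2 * p)" for f
  have pw: "p ^ j \<le> p" if "0 < j" for j
    using power_decreasing[of 1 j p] that p by auto
  have factor: "exp (- h f) \<le> 1 - p ^ card (f - U)" if f: "f \<in> E - S" for f
  proof -
    define x where "x = p ^ card (f - U)"
    have fin: "finite f" "finite U" "card f = k"
      using f finite_edge card_edge UV finite_verts finite_subset by auto
    \<comment> \<open>Inducedness of \<open>S\<close> enters here: every other edge needs a further
      vertex, so its conditional probability is at most \<open>p\<close>.\<close>
    have "f - U \<noteq> {}" using f ind by auto
    then have "0 < card (f - U)" using fin by (simp add: card_gt_0_iff)
    then have x: "0 \<le> x" "x \<le> p" "x \<le> 1/2"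
      using pw[of "card (f - U)"] p by (auto simp: x_def)
    then have x2: "x + 2 * x\<^sup>2 \<le> 2 * x"
      using mult_left_mono[of x "1/2" x] by (simp add: power2_eq_square)
    have cf: "card (f - U) = k - card (f \<inter> U)"
      using fin card_Diff_subset_Int[of f U] by simp
    have "x + 2 * x\<^sup>2 \<le> h f"
    proof -
      consider "card (f \<inter> U) = 0" | "card (f \<inter> U) = 1" | "2 \<le> card (f \<inter> U)" by linarith
      then show ?thesis
      proof cases
        case 1
        then have "x = p ^ k" using cf by (simp add: x_def)
        then have "x + 2 * x\<^sup>2 = p ^ k + 2 * p ^ (2 * k)"
          by (simp add: power_mult[symmetric] mult.commute)
        then show ?thesis using p by (simp add: h_def)
      next
        case 2
        then have "f \<in> F1" using f by (auto simp: F1_def)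
        then have "2 * p ^ (k - 1) \<le> h f" using p by (simp add: h_def)
        moreover have "x = p ^ (k - 1)" using 2 cf by (simp add: x_def)
        ultimately show ?thesis using x2 by linarith
      next
        case 3
        then have "f \<in> F2" using f by (auto simp: F2_def)
        then have "2 * p \<le> h f" using p by (simp add: h_def)
        then show ?thesis using x2 x by linarith
      qed
    qed
    then have "- h f \<le> ln (1 - x)"
      using ln_one_minus_pos_lower_bound[of x] x by simp
    then have "exp (- h f) \<le> exp (ln (1 - x))" by simp
    also have "\<dots> = 1 - x" using x by simp
    finally show ?thesis by (simp add: x_def)
  qed
  have h_nonneg: "0 \<le> h f" for f using p by (simp add: h_def)
  have "(\<Sum>f\<in>E - S. h f) \<le> (\<Sum>f\<in>E. h f)"
    using finite_edges h_nonneg by (intro sum_mono2) auto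
  also have "\<dots> = real (card E) * (p ^ k + 2 * p ^ (2 * k)) + real (card F1) * (2 * p ^ (k - 1))
      + real (card F2) * (2 * p)"
    using finite_edges
    by (simp add: h_def sum.distrib F1_def F2_def Int_def distrib_left flip: sum_distrib_right)
  also have "\<dots> \<le> real (card E) * (p ^ k + 2 * p ^ (2 * k)) + real k * m * d * (2 * p ^ (k - 1))
      + (real k * m)\<^sup>2 * b * (2 * p)"
    using card_edges_meeting_le[OF UV] card_edges_meeting_twice_le[OF UV] p cU
    unfolding F1_def F2_def by (intro add_mono mult_right_mono) auto
  finally have sum_h: "(\<Sum>f\<in>E - S. h f) \<le> real (card E) * (p ^ k + 2 * p ^ (2 * k))
      + real k * m * d * (2 * p ^ (k - 1)) + (real k * m)\<^sup>2 * b * (2 * p)" .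
  have "exp (- (real (card E) * (p ^ k + 2 * p ^ (2 * k))
      + real k * m * d * (2 * p ^ (k - 1)) + (real k * m)\<^sup>2 * b * (2 * p)))
      \<le> exp (\<Sum>f\<in>E - S. - h f)"
    using sum_h by (simp add: sum_negf)
  also have "\<dots> = (\<Prod>f\<in>E - S. exp (- h f))"
    using finite_edges by (intro exp_sum) auto
  also have "\<dots> \<le> (\<Prod>f\<in>E - S. 1 - p ^ card (f - U))"
    using factor by (intro prod_mono) auto
  also have "\<dots> \<le> subset_expectation (V - U) p (\<lambda>W. of_bool (\<forall>f\<in>E - S. \<not> f - U \<subseteq> W))"
    using p finite_edges finite_verts edge_subset
    by (intro subset_expectation_avoid_ge) auto
  also have "\<dots> = subset_expectation (V - U) p (\<lambda>W. of_bool (\<forall>f\<in>E - S. \<not> f \<subseteq> U \<union> W))"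
    by (simp add: Diff_subset_conv)
  finally have "p ^ (k * m) * exp (- (real (card E) * (p ^ k + 2 * p ^ (2 * k))
      + real k * m * d * (2 * p ^ (k - 1)) + (real k * m)\<^sup>2 * b * (2 * p)))
      \<le> p ^ card U * subset_expectation (V - U) p (\<lambda>W. of_bool (\<forall>f\<in>E - S. \<not> f \<subseteq> U \<union> W))"
    unfolding cU(1) using p by (intro mult_left_mono) auto
  also have "\<dots> = subset_expectation V p
      (\<lambda>W. of_bool (U \<subseteq> W) * of_bool (\<forall>f\<in>E - S. \<not> f \<subseteq> W))"
    using subset_expectation_superset[OF finite_verts UV] by simp
  also have "\<dots> \<le> subset_expectation V p (\<lambda>W. of_bool ({f \<in> E. f \<subseteq> W} = S))"
  proof (rule subset_expectation_mono)
    fix W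
    have "{f \<in> E. f \<subseteq> W} = S" if "U \<subseteq> W" "\<forall>f\<in>E - S. \<not> f \<subseteq> W"
      using that SE by (auto simp: U_def)
    then show "of_bool (U \<subseteq> W) * of_bool (\<forall>f\<in>E - S. \<not> f \<subseteq> W)
        \<le> (of_bool ({f \<in> E. f \<subseteq> W} = S) :: real)"
      by auto
  qed (use p in auto)
  finally show ?thesis .
qed

text \<open>The events that the edge set is exactly \<open>S\<close> are disjoint, so their
  probabilities add up. In \<open>c\<close>, the last summand is the loss in counting matchings, and
  the others are the error terms of \<open>prob_edges_eq_ge\<close>.\<close>

lemma prob_card_edges_ge:
  assumes p: "0 < p" "p \<le> 1/2" and N: "finite N" "\<And>m. m \<in> N \<Longrightarrow> real m \<le> M"
    and M: "0 \<le> M" "blocking_bound M \<le> card E / 2" and E: "E \<noteq> {}"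
  defines "\<mu> \<equiv> real (card E) * p ^ k"
  defines "c \<equiv> real (card E) * (2 * p ^ (2 * k)) + real k * M * d * (2 * p ^ (k - 1))
    + (real k * M)\<^sup>2 * b * (2 * p) + 2 * M * blocking_bound M / card E"
  shows "exp (- c) * (\<Sum>m\<in>N. exp (- \<mu>) * \<mu> ^ m / fact m)
    \<le> subset_expectation V p (\<lambda>W. of_bool (card {f \<in> E. f \<subseteq> W} \<in> N))"
proof -
  let ?SE = "subset_expectation V p"
  have cE: "0 < real (card E)" using E finite_edges by (simp add: card_gt_0_iff)
  have B: "0 \<le> blocking_bound M"
    using blocking_bound_mono[of 0 M] M by (simp add: blocking_bound_def)
  \<comment> \<open>An upper bound for the proportion of blocked edges. As \<open>x <= 1/2\<close>,
    the counting factor \<open>(1 - x) ^ m\<close> is at least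
    \<open>exp (- 2 * m * x)\<close>.\<close>
  define x where "x = blocking_bound M / card E"
  have x: "0 \<le> x" "x \<le> 1/2" using B M cE by (auto simp: x_def field_simps)
  define r where "r m = exp (- (real (card E) * (p ^ k + 2 * p ^ (2 * k))
      + real k * m * d * (2 * p ^ (k - 1)) + (real k * m)\<^sup>2 * b * (2 * p)))" for m :: real
  have "exp (- c) * (exp (- \<mu>) * \<mu> ^ m / fact m)
      \<le> (\<Sum>S\<in>induced_matchings m. ?SE (\<lambda>W. of_bool ({f \<in> E. f \<subseteq> W} = S)))" if "m \<in> N" for m
  proof -
    have m: "real m \<le> M" using N that by auto
    have "x * x \<le> x * (1/2)" using x by (intro mult_left_mono)
    then have "exp (- 2 * x) \<le> exp (ln (1 - x))"
      using ln_one_minus_pos_lower_bound[OF x] by (simp add: power2_eq_square)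
    then have "exp (- 2 * x) \<le> 1 - x" using x by simp
    then have "exp (- 2 * x) ^ m \<le> (1 - x) ^ m" by (intro power_mono) auto
    moreover have "exp (- 2 * x) ^ m = exp (- 2 * real m * x)"
      by (simp add: exp_of_nat_mult[symmetric])
    moreover have "exp (- 2 * M * x) \<le> exp (- 2 * real m * x)"
      using m x by (simp add: mult_right_mono)
    ultimately have x_pow: "exp (- 2 * M * x) \<le> (1 - x) ^ m" by linarith
    have "r M \<le> r (real m)"
      unfolding r_def exp_le_cancel_iff neg_le_iff_le using m p b_nonneg d_nonneg
      by (intro add_mono mult_right_mono mult_left_mono power_mono order_refl) auto
    moreover have "exp (- c) * exp (- \<mu>) = r M * exp (- 2 * M * x)"
      by (simp add: r_def c_def \<mu>_def x_def exp_add[symmetric] algebra_simps)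
    ultimately have "exp (- c) * exp (- \<mu>) \<le> r (real m) * (1 - x) ^ m"
      by (simp only:) (intro mult_mono x_pow, auto simp: r_def)
    then have "exp (- c) * exp (- \<mu>) * (\<mu> ^ m / fact m)
        \<le> r (real m) * (1 - x) ^ m * (\<mu> ^ m / fact m)"
      using p by (intro mult_right_mono) (auto simp: \<mu>_def)
    also have "\<dots> = (real (card E) * (1 - x)) ^ m / fact m * (p ^ (k * m) * r (real m))"
      by (simp add: \<mu>_def power_mult_distrib power_mult mult_ac)
    also have "real (card E) * (1 - x) = real (card E) - blocking_bound M"
      using cE by (simp add: x_def algebra_simps)
    also have "(real (card E) - blocking_bound M) ^ m / fact m * (p ^ (k * m) * r (real m))
        \<le> card (induced_matchings m) * (p ^ (k * m) * r (real m))"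
      using m M p card_induced_matchings_ge[of m M]
      by (intro mult_right_mono) (auto simp: r_def)
    also have "\<dots> \<le> (\<Sum>S\<in>induced_matchings m. ?SE (\<lambda>W. of_bool ({f \<in> E. f \<subseteq> W} = S)))"
      unfolding r_def using prob_edges_eq_ge[OF p] by (intro sum_bounded_below) simp
    finally show ?thesis by simp
  qed
  then have "exp (- c) * (\<Sum>m\<in>N. exp (- \<mu>) * \<mu> ^ m / fact m)
      \<le> (\<Sum>m\<in>N. \<Sum>S\<in>induced_matchings m. ?SE (\<lambda>W. of_bool ({f \<in> E. f \<subseteq> W} = S)))"
    unfolding sum_distrib_left by (rule sum_mono)
  also have "\<dots> = ?SE (\<lambda>W. \<Sum>m\<in>N. \<Sum>S\<in>induced_matchings m. of_bool ({f \<in> E. f \<subseteq> W} = S))"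
    by (simp only: subset_expectation_sum)
  also have "\<dots> \<le> ?SE (\<lambda>W. of_bool (card {f \<in> E. f \<subseteq> W} \<in> N))"
  proof (rule subset_expectation_mono)
    fix W
    let ?F = "{f \<in> E. f \<subseteq> W}"
    \<comment> \<open>For fixed \<open>W\<close> at most one \<open>S\<close> equals
      \<open>?F\<close>, and then \<open>?F\<close> has \<open>m\<close> elements.\<close>
    have "(\<Sum>S\<in>induced_matchings m. of_bool (?F = S)) \<le> (of_bool (card ?F = m) :: real)" for m
    proof -
      have "(\<Sum>S\<in>induced_matchings m. of_bool (?F = S)) = (of_bool (?F \<in> induced_matchings m) :: real)"
        using finite_induced_matchings[of m] by (simp add: of_bool_def sum.delta')
      also have "\<dots> \<le> of_bool (card ?F = m)"
        by (auto simp: induced_matchings_def)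
      finally show ?thesis .
    qed
    then have "(\<Sum>m\<in>N. \<Sum>S\<in>induced_matchings m. of_bool (?F = S))
        \<le> (\<Sum>m\<in>N. of_bool (card ?F = m) :: real)"
      by (rule sum_mono)
    also have "\<dots> = of_bool (card ?F \<in> N)"
      using N by (simp add: of_bool_def sum.delta')
    finally show "(\<Sum>m\<in>N. \<Sum>S\<in>induced_matchings m. of_bool (?F = S))
        \<le> (of_bool (card ?F \<in> N) :: real)" .
  qed (use p in auto)
  finally show ?thesis .
qed

end

subsection \<open>The sparse regime\<close>

lemma card_pair_edges_le_Delta2:
  assumes "finite (hverts H)" "u \<in> hverts H" "v \<in> hverts H" "u \<noteq> v"
  shows "card {e \<in> hedges H. u \<in> e \<and> v \<in> e} \<le> Delta2 H"
proof -
  let ?C = "{card {e \<in> hedges H. u \<in> e \<and> v \<in> e} | u v.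
        u \<in> hverts H \<and> v \<in> hverts H \<and> u \<noteq> v}"
  have "?C \<subseteq> (\<lambda>(u, v). card {e \<in> hedges H. u \<in> e \<and> v \<in> e}) ` (hverts H \<times> hverts H)"
    by auto
  then have "finite ?C" by (rule finite_subset) (use assms in simp)
  then show ?thesis unfolding Delta2_def using assms by (intro Max_ge) auto
qed

text \<open>Every edge through \<open>u\<close> contains a second vertex, so the codegrees of
  \<open>u\<close> with the other vertices cover its degree.\<close>

lemma degree_le_codegree:
  assumes fin: "finite V" and E: "\<And>e. e \<in> E \<Longrightarrow> e \<subseteq> V \<and> 2 \<le> card e" and "u \<in> V" "0 \<le> b"
    and codeg: "\<And>v. \<lbrakk>v \<in> V; u \<noteq> v\<rbrakk> \<Longrightarrow> real (card {e \<in> E. u \<in> e \<and> v \<in> e}) \<le> b"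
  shows "real (card {e \<in> E. u \<in> e}) \<le> real (card V) * b"
proof -
  have "\<exists>v\<in>V - {u}. v \<in> e" if e: "e \<in> E" for e
  proof -
    have "2 \<le> card e" using E[OF e] by simp
    then obtain x y where "x \<in> e" "y \<in> e" "x \<noteq> y" by (rule two_le_cardE)
    then show ?thesis using E[OF e] by blast
  qed
  then have "{e \<in> E. u \<in> e} = (\<Union>v\<in>V - {u}. {e \<in> E. u \<in> e \<and> v \<in> e})" by blast
  moreover have "real (card (\<Union>v\<in>V - {u}. {e \<in> E. u \<in> e \<and> v \<in> e})) \<le> real (card (V - {u})) * b"
    using fin by (intro card_UN_le_mult) (auto intro: codeg)
  moreover have "real (card (V - {u})) * b \<le> real (card V) * b"
    using fin \<open>0 \<le> b\<close> by (intro mult_right_mono) (auto intro: card_mono)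
  ultimately show ?thesis by simp
qed

lemma num_edges_induced: "num_edges (induced H W) = card {e \<in> hedges H. e \<subseteq> W}"
  by (simp add: num_edges_def induced_def)

lemma prob_num_edges_eq:
  assumes "finite (hverts H)" "0 \<le> p" "p \<le> 1"
  shows "measure_pmf.prob (random_induced H p) {G. P (num_edges G)}
    = subset_expectation (hverts H) p (\<lambda>W. of_bool (P (card {e \<in> hedges H. e \<subseteq> W})))"
proof -
  have "measure_pmf.prob (random_induced H p) {G. P (num_edges G)}
      = measure_pmf.prob (random_verts H p) {W. P (card {e \<in> hedges H. e \<subseteq> W})}"
    by (simp add: random_induced_def vimage_def num_edges_induced)
  also have "\<dots> = measure_pmf.expectation (random_verts H p)
      (indicator {W. P (card {e \<in> hedges H. e \<subseteq> W})})"
    by simp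
  also have "\<dots> = subset_expectation (hverts H) p (indicator {W. P (card {e \<in> hedges H. e \<subseteq> W})})"
    by (rule expectation_random_verts[OF assms])
  also have "\<dots> = subset_expectation (hverts H) p (\<lambda>W. of_bool (P (card {e \<in> hedges H. e \<subseteq> W})))"
    by (intro subset_expectation_cong) (simp add: indicator_def)
  finally show ?thesis .
qed

lemma mean_edges_eq:
  assumes H: "uniform_hypergraph k H" and p: "0 \<le> p" "p \<le> 1"
  shows "mean_edges H p = real (num_edges H) * p ^ k"
proof -
  have fin: "finite (hverts H)" and E: "\<And>e. e \<in> hedges H \<Longrightarrow> e \<subseteq> hverts H \<and> card e = k"
    using H by (auto simp: uniform_hypergraph_def)
  have "finite (hedges H)"
    using fin E by (intro finite_subset[of "hedges H" "Pow (hverts H)"]) auto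
  then have "real (card {e \<in> hedges H. e \<subseteq> W}) = (\<Sum>e\<in>hedges H. of_bool (e \<subseteq> W))" for W
    by (simp add: Int_def)
  then have "mean_edges H p = subset_expectation (hverts H) p (\<lambda>W. \<Sum>e\<in>hedges H. of_bool (e \<subseteq> W))"
    using expectation_random_verts[OF fin p]
    by (simp add: mean_edges_def random_induced_def num_edges_induced)
  also have "\<dots> = (\<Sum>e\<in>hedges H. subset_expectation (hverts H) p (\<lambda>W. of_bool (e \<subseteq> W)))"
    by (rule subset_expectation_sum)
  also have "\<dots> = (\<Sum>e\<in>hedges H. p ^ k)"
    using E fin by (intro sum.cong) (simp_all add: subset_expectation_of_bool_superset)
  finally show ?thesis by (simp add: num_edges_def)
qed

text \<open>Below, \<open>T = n powr (2 / (3 * k + 1))\<close>, so that the hypothesis on \<open>p\<close> reads \<open>p * T ^ 3 \<le> 1\<close>;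
  both \<open>\<mu>\<close> and \<open>n powr (1 / (2 * k))\<close> are \<open>O(T)\<close>, so matchings of size \<open>O(T)\<close> suffice.\<close>

context
  fixes k :: nat and n T p :: real
  assumes k: "3 \<le> k" and n: "0 < n" and T: "1 \<le> T" "T ^ (3 * k + 1) = n\<^sup>2"
    and p: "0 < p" "p * T ^ 3 \<le> 1"
begin

text \<open>As \<open>p <= 1 / T ^ 3\<close>, the monomial is at most
  \<open>T ^ i / T ^ (3 * j)\<close>. The estimates on \<open>p\<close> below reduce to this
  comparison of exponents.\<close>

lemma mult_power_le_one:
  assumes "i \<le> 3 * j"
  shows "T ^ i * p ^ j \<le> 1"
proof -
  have "T ^ i * p ^ j \<le> T ^ (3 * j) * p ^ j"
    using assms T p by (intro mult_right_mono power_increasing) auto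
  also have "\<dots> = (p * T ^ 3) ^ j"
    unfolding power_mult[of T 3 j] by (simp add: power_mult_distrib)
  also have "\<dots> \<le> 1" using T p by (intro power_le_one) auto
  finally show ?thesis .
qed

lemma T_power_le: "T ^ 5 \<le> n"
proof (rule power2_le_imp_le)
  have "T ^ 10 \<le> T ^ (3 * k + 1)" using T k by (intro power_increasing) auto
  then show "(T ^ 5)\<^sup>2 \<le> n\<^sup>2" using T by (simp add: power_mult[symmetric])
qed (use n in auto)

lemma mean_le: "n\<^sup>2 * p ^ k \<le> T"
proof -
  have "n\<^sup>2 * p ^ k = T * (T ^ (3 * k) * p ^ k)" by (simp flip: T(2))
  also have "\<dots> \<le> T * 1" using T by (intro mult_left_mono mult_power_le_one) auto
  finally show ?thesis by simp
qed

lemma square_term_le: "n\<^sup>2 * p ^ (2 * k) \<le> 1"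
  unfolding T(2)[symmetric] using k by (intro mult_power_le_one) auto

text \<open>Only \<open>n\<^sup>2\<close> is given as a power of \<open>T\<close>, hence the
  squaring. The exponent condition is \<open>3 * k + 3 <= 6 * (k - 1)\<close>, with equality at
  \<open>k = 3\<close>.\<close>

lemma single_term_le: "n * T * p ^ (k - 1) \<le> 1"
proof (rule power2_le_imp_le)
  have "(n * T * p ^ (k - 1))\<^sup>2 = T ^ (3 * k + 1 + 2) * p ^ (2 * (k - 1))"
    unfolding power_add[of T "3 * k + 1" 2] T(2)
    by (simp add: power_mult_distrib power_mult[symmetric] mult.commute)
  also have "\<dots> \<le> 1" using k by (intro mult_power_le_one) auto
  finally show "(n * T * p ^ (k - 1))\<^sup>2 \<le> 1\<^sup>2" by simp
qed simp

lemma double_term_le: "T\<^sup>2 * p \<le> 1"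
  using mult_power_le_one[of 2 1] by simp

end

text \<open>With matchings of size at most \<open>K * T\<close>, blocking is of order
  \<open>T\<^sup>2 * n\<close> against order \<open>n\<^sup>2\<close> edges. The assumption
  \<open>large\<close> makes this at most half of them, and the total counting loss has order
  \<open>T ^ 3 / n\<close>, which is bounded since \<open>T ^ 5 <= n\<close>.\<close>

lemma (in sparse_hypergraph) error_terms_le:
  fixes a D K n T p :: real
  defines "M \<equiv> K * T"
  assumes n: "0 < n" and T: "2 \<le> T" "T ^ (3 * k + 1) = n\<^sup>2" and p: "0 < p" "p * T ^ 3 \<le> 1"
    and K: "1 \<le> K" and D: "1 \<le> D" and a: "0 < a"
    and E: "a * n\<^sup>2 \<le> card E" "card E \<le> D ^ 3 * n\<^sup>2" and bd: "b = D" "d = D\<^sup>2 * n"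
    and large: "6 * real k ^ 3 * D ^ 3 * K\<^sup>2 / a \<le> T"
  shows "p \<le> 1/2" "blocking_bound M \<le> card E / 2"
    "real (card E) * (2 * p ^ (2 * k)) + real k * M * d * (2 * p ^ (k - 1))
      + (real k * M)\<^sup>2 * b * (2 * p) + 2 * M * blocking_bound M / card E
     \<le> 2 * D ^ 3 + 2 * real k * K * D\<^sup>2 + 2 * (real k)\<^sup>2 * K\<^sup>2 * D + 6 * real k ^ 3 * D ^ 3 * K ^ 3 / a"
proof -
  have T1: "1 \<le> T" using T by simp
  note bounds = k_ge_3 n T1 T(2) p
  have M: "1 \<le> M" using K T by (simp add: M_def mult_ge1_I)
  have "p * 2 \<le> p * T ^ 3"
    using T p self_le_power[of T 3] by (intro mult_left_mono) auto
  then show "p \<le> 1/2" using p by linarith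
  \<comment> \<open>Chosen so that \<open>blocking_bound M <= Q * T\<^sup>2 * n / 2\<close>; the
    assumption \<open>large\<close> then reads \<open>Q <= a * T\<close>.\<close>
  define Q where "Q = 6 * real k ^ 3 * D ^ 3 * K\<^sup>2"
  have Q: "0 \<le> Q" using D by (simp add: Q_def)
  have cE: "0 < real (card E)" using E n a by (smt (verit) mult_pos_pos zero_less_power)
  \<comment> \<open>As \<open>k\<close>, \<open>D\<close> and \<open>M\<close> are at least 1, one
    monomial dominates all three summands.\<close>
  have "blocking_bound M \<le> 3 * (real k ^ 3 * D ^ 3 * M\<^sup>2 * n)"
  proof -
    have pos: "1 \<le> real k" using k_ge_3 by simp
    have "real k * M * d \<le> real k ^ 3 * D ^ 3 * M\<^sup>2 * n"
      unfolding bd using M D n pos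
        mult_mono[OF mult_mono[OF self_le_power[of "real k" 3] self_le_power[of M 2]]
          power_increasing[of 2 3 D]]
      by (simp add: mult_ac)
    moreover have "real k * ((real k * M)\<^sup>2 * b) * d = real k ^ 3 * D ^ 3 * M\<^sup>2 * n"
      by (simp add: bd power2_eq_square power3_eq_cube)
    moreover have "real k * M * d * ((real k)\<^sup>2 * b) = real k ^ 3 * D ^ 3 * M * n"
      by (simp add: bd power2_eq_square power3_eq_cube)
    moreover have "real k ^ 3 * D ^ 3 * M * n \<le> real k ^ 3 * D ^ 3 * M\<^sup>2 * n"
      using M D n self_le_power[of M 2] by (intro mult_right_mono mult_left_mono) auto
    ultimately show ?thesis unfolding blocking_bound_def by linarith
  qed
  also have "\<dots> = Q * T\<^sup>2 * n / 2" by (simp add: Q_def M_def power_mult_distrib)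
  finally have B: "blocking_bound M \<le> Q * T\<^sup>2 * n / 2" .
  have T3: "T\<^sup>2 * T \<le> n" "T\<^sup>2 * T = T ^ 3"
    using T_power_le[OF bounds] power_increasing[of 3 5 T] T1
    by (auto simp: power2_eq_square power3_eq_cube)
  have "Q \<le> a * T" using large a by (simp add: Q_def field_simps)
  then have "Q * T\<^sup>2 \<le> a * T * T\<^sup>2" by (rule mult_right_mono) simp
  also have "\<dots> = a * (T\<^sup>2 * T)" by simp
  also have "\<dots> \<le> a * n" using T3 a by (intro mult_left_mono) auto
  finally have "Q * T\<^sup>2 * n / 2 \<le> a * n * n / 2" using n by (simp add: mult_right_mono)
  then show "blocking_bound M \<le> card E / 2" using B E by (simp add: power2_eq_square)
  have "real (card E) * (2 * p ^ (2 * k)) \<le> D ^ 3 * n\<^sup>2 * (2 * p ^ (2 * k))"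
    using E p by (intro mult_right_mono) auto
  also have "\<dots> = 2 * D ^ 3 * (n\<^sup>2 * p ^ (2 * k))" by simp
  also have "\<dots> \<le> 2 * D ^ 3 * 1"
    using D square_term_le[OF bounds] by (intro mult_left_mono) auto
  finally have t1: "real (card E) * (2 * p ^ (2 * k)) \<le> 2 * D ^ 3" by simp
  have "real k * M * d * (2 * p ^ (k - 1)) = 2 * real k * K * D\<^sup>2 * (n * T * p ^ (k - 1))"
    by (simp add: M_def bd)
  also have "\<dots> \<le> 2 * real k * K * D\<^sup>2 * 1"
    using D K single_term_le[OF bounds] by (intro mult_left_mono) auto
  finally have t2: "real k * M * d * (2 * p ^ (k - 1)) \<le> 2 * real k * K * D\<^sup>2" by simp
  have "(real k * M)\<^sup>2 * b * (2 * p) = 2 * (real k)\<^sup>2 * K\<^sup>2 * D * (T\<^sup>2 * p)"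
    by (simp add: M_def bd power_mult_distrib)
  also have "\<dots> \<le> 2 * (real k)\<^sup>2 * K\<^sup>2 * D * 1"
    using D K double_term_le[OF bounds] by (intro mult_left_mono) auto
  finally have t3: "(real k * M)\<^sup>2 * b * (2 * p) \<le> 2 * (real k)\<^sup>2 * K\<^sup>2 * D" by simp
  have "2 * M * blocking_bound M / card E \<le> 2 * M * (Q * T\<^sup>2 * n / 2) / (a * n\<^sup>2)"
    using M B E Q n a by (intro frac_le mult_left_mono) auto
  also have "\<dots> = K * Q / a * ((T\<^sup>2 * T) / n)"
    using n by (simp add: M_def power2_eq_square)
  also have "\<dots> \<le> K * Q / a * 1"
    using K Q a n T3 by (intro mult_left_mono) (auto simp: field_simps)
  also have "\<dots> = 6 * real k ^ 3 * D ^ 3 * K ^ 3 / a"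
    by (simp add: Q_def power2_eq_square power3_eq_cube)
  finally have t4: "2 * M * blocking_bound M / card E \<le> 6 * real k ^ 3 * D ^ 3 * K ^ 3 / a" .
  show "real (card E) * (2 * p ^ (2 * k)) + real k * M * d * (2 * p ^ (k - 1))
      + (real k * M)\<^sup>2 * b * (2 * p) + 2 * M * blocking_bound M / card E
     \<le> 2 * D ^ 3 + 2 * real k * K * D\<^sup>2 + 2 * (real k)\<^sup>2 * K\<^sup>2 * D + 6 * real k ^ 3 * D ^ 3 * K ^ 3 / a"
    by (rule add_mono[OF add_mono[OF add_mono[OF t1 t2] t3] t4])
qed

text \<open>Codegrees at most \<open>D\<close> on at most \<open>D * n\<close> vertices give degrees
  at most \<open>D\<^sup>2 * n\<close>; summing degrees over the vertices bounds the number of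
  edges, and hence \<mu> from above.\<close>

lemma uniform_sparse_hypergraph:
  fixes D n :: real
  assumes H: "uniform_hypergraph k H" "3 \<le> k" and v: "real (num_verts H) \<le> D * n"
    and D: "real (Delta2 H) \<le> D" "0 \<le> D" and n: "0 \<le> n"
  shows "sparse_hypergraph (hverts H) (hedges H) k D (D\<^sup>2 * n)"
    and "real (num_edges H) \<le> D ^ 3 * n\<^sup>2"
proof -
  have fin: "finite (hverts H)" and E: "\<And>e. e \<in> hedges H \<Longrightarrow> e \<subseteq> hverts H \<and> card e = k"
    using H by (auto simp: uniform_hypergraph_def)
  have codeg: "real (card {e \<in> hedges H. u \<in> e \<and> v \<in> e}) \<le> D"
    if "u \<in> hverts H" "v \<in> hverts H" "u \<noteq> v" for u v
    using card_pair_edges_le_Delta2[OF fin that] D by linarith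
  have deg: "real (card {e \<in> hedges H. u \<in> e}) \<le> D\<^sup>2 * n" if "u \<in> hverts H" for u
  proof -
    have "real (card {e \<in> hedges H. u \<in> e}) \<le> real (card (hverts H)) * D"
      using fin E H D that codeg by (intro degree_le_codegree) auto
    also have "\<dots> \<le> D * n * D"
      using v D by (intro mult_right_mono) (auto simp: num_verts_def)
    finally show ?thesis by (simp add: power2_eq_square mult_ac)
  qed
  show sp: "sparse_hypergraph (hverts H) (hedges H) k D (D\<^sup>2 * n)"
    using fin E H codeg deg D n by unfold_locales auto
  interpret sparse_hypergraph "hverts H" "hedges H" k D "D\<^sup>2 * n" by (rule sp)
  have "e \<inter> hverts H \<noteq> {}" if "e \<in> hedges H" for e
    using that E[OF that] H(2) by (metis Int_absorb2 card.empty not_numeral_le_zero)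
  then have "{e \<in> hedges H. e \<inter> hverts H \<noteq> {}} = hedges H" by blast
  then have "real (num_edges H) \<le> real (card (hverts H)) * (D\<^sup>2 * n)"
    using card_edges_meeting_le[of "hverts H"] by (simp add: num_edges_def)
  also have "\<dots> \<le> D * n * (D\<^sup>2 * n)"
    using v n by (intro mult_right_mono) (auto simp: num_verts_def)
  finally show "real (num_edges H) \<le> D ^ 3 * n\<^sup>2"
    by (simp add: power2_eq_square power3_eq_cube mult_ac)
qed

lemma exists_large_powr:
  fixes R x :: real
  assumes "0 < R" "0 < x"
  shows "\<exists>n0::nat. 0 < n0 \<and> (\<forall>n\<ge>n0. R \<le> real n powr x)"
proof -
  define n0 where "n0 = Suc (nat \<lceil>R powr (1 / x)\<rceil>)"
  have "R \<le> real n powr x" if "n \<ge> n0" for n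
  proof -
    have "R powr (1 / x) \<le> real n" using that unfolding n0_def by linarith
    then have "(R powr (1 / x)) powr x \<le> real n powr x"
      using assms by (intro powr_mono2) auto
    then show ?thesis using assms by (simp add: powr_powr)
  qed
  then show ?thesis by (intro exI[of _ n0]) (auto simp: n0_def)
qed

section \<open>Choice of constants and conclusion\<close>

theorem theorem4p3:
  fixes k :: nat and a D :: real
  assumes "k \<ge> 3" and "a > 0" and "D \<ge> 1"
  shows "\<exists>(n0::nat) (c::real) (d::real). n0 > 0 \<and> c > 0 \<and> d > 0 \<and>
    (\<forall>(n::nat) (H :: 'a hypergraph) (p::real) (t::real).
       n \<ge> n0 \<longrightarrow>
       uniform_hypergraph k H \<longrightarrow>
       real (num_verts H) \<le> D * real n \<longrightarrow>
       real (num_edges H) \<ge> a * (real n)^2 \<longrightarrow>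
       real (Delta2 H) \<le> D \<longrightarrow>
       0 < p \<longrightarrow> p \<le> real n powr (- 2 / (real k + 1 / 3)) \<longrightarrow>
       0 \<le> t \<longrightarrow>
       (let \<mu> = mean_edges H p in
          1 \<le> \<mu> + t \<longrightarrow>
          \<mu> + t \<le> 9 * max \<mu> (real n powr (1 / (2 * real k))) \<longrightarrow>
          measure_pmf.prob (random_induced H p) {G. real (num_edges G) \<ge> \<mu> + t}
            \<ge> d * exp (- c * phi (t / \<mu>) * \<mu>) \<and>
          d * exp (- c * phi (t / \<mu>) * \<mu>) \<ge> d * exp (- c * t^2 / \<mu>)))"
proof -
  \<comment> \<open>The window ends at \<open>s + sqrt s <= 2 * s\<close>, and
    \<open>s <= 9 * D ^ 3 * T\<close> is shown below, so matchings of size at most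
    \<open>K * T\<close> are enough.\<close>
  define K where "K = 18 * D ^ 3"
  define C where "C = 2 * D ^ 3 + 2 * real k * K * D\<^sup>2 + 2 * (real k)\<^sup>2 * K\<^sup>2 * D
    + 6 * real k ^ 3 * D ^ 3 * K ^ 3 / a"
  define d where "d = exp (- C) * (exp (- 11 / 2) / (2 * sqrt 2))"
  \<comment> \<open>With \<open>T = n powr x\<close> this gives
    \<open>T ^ (3 * k + 1) = n\<^sup>2\<close>, and the exponent in the bound on \<open>p\<close> is
    \<open>- 3 * x\<close>.\<close>
  define x where "x = 2 / (3 * real k + 1)"
  have D3: "1 \<le> D ^ 3" using assms by simp
  then have K: "1 \<le> K" by (simp add: K_def)
  have d: "0 < d" by (simp add: d_def)
  have "3 * real k + 1 \<noteq> 0" by linarith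
  then have x: "0 < x" "(3 * real k + 1) * x = 2"
    unfolding x_def by (simp, metis nonzero_mult_div_cancel_left times_divide_eq_right)
  \<comment> \<open>The two entries ensure \<open>2 <= T\<close>, which gives
    \<open>p <= 1/2\<close>, and the assumption \<open>large\<close> of
    \<open>error_terms_le\<close>.\<close>
  define R where "R = max 2 (6 * real k ^ 3 * D ^ 3 * K\<^sup>2 / a)"
  obtain n0 :: nat where n0: "0 < n0" "\<And>n. n \<ge> n0 \<Longrightarrow> R \<le> real n powr x"
    using exists_large_powr[of R x] x(1) by (auto simp: R_def less_max_iff_disj)
  have main: "d * exp (- 9 * phi (t / \<mu>) * \<mu>)
        \<le> measure_pmf.prob (random_induced H p) {G. real (num_edges G) \<ge> \<mu> + t}
      \<and> d * exp (- 9 * t\<^sup>2 / \<mu>) \<le> d * exp (- 9 * phi (t / \<mu>) * \<mu>)"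
    if n: "n \<ge> n0" and H: "uniform_hypergraph k H" "real (num_verts H) \<le> D * real n"
        "real (num_edges H) \<ge> a * (real n)\<^sup>2" "real (Delta2 H) \<le> D"
      and p: "0 < p" "p \<le> real n powr (- 2 / (real k + 1 / 3))"
      and t: "0 \<le> t" "1 \<le> \<mu> + t" "\<mu> + t \<le> 9 * max \<mu> (real n powr (1 / (2 * real k)))"
      and \<mu>: "\<mu> = mean_edges H p"
    for n p t \<mu> and H :: "'a hypergraph"
  proof -
    define T where "T = real n powr x"
    define s where "s = \<mu> + t"
    define N where "N = {m::nat. s \<le> real m \<and> real m \<le> s + sqrt s}"
    have n1: "1 \<le> real n" using n n0 by simp
    have T: "2 \<le> T" "6 * real k ^ 3 * D ^ 3 * K\<^sup>2 / a \<le> T"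
      using n0(2)[OF n] by (auto simp: T_def R_def)
    have TE: "T ^ j = real n powr (real j * x)" for j
      using n1 by (simp add: T_def powr_powr mult.commute flip: powr_realpow)
    have "real (3 * k + 1) * x = 2" using x by (simp add: add.commute)
    then have T_pow: "T ^ (3 * k + 1) = (real n)\<^sup>2" using n1 by (simp only: TE) simp
    have "real k + 1 / 3 \<noteq> 0" by linarith
    then have "2 / (real k + 1 / 3) = 3 * x"
      using x(2) by (simp add: divide_eq_eq algebra_simps)
    then have "- 2 / (real k + 1 / 3) = - (real 3 * x)" by simp
    then have "p * T ^ 3 \<le> real n powr (- (real 3 * x)) * real n powr (real 3 * x)"
      unfolding TE using p by (intro mult_right_mono) auto
    also have "\<dots> = 1" using n1 by (simp flip: powr_add)
    finally have pT: "p * T ^ 3 \<le> 1" .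
    interpret sparse_hypergraph "hverts H" "hedges H" k D "D\<^sup>2 * real n"
      using uniform_sparse_hypergraph(1)[OF H(1) _ H(2,4)] assms by simp
    have E: "a * (real n)\<^sup>2 \<le> card (hedges H)" "card (hedges H) \<le> D ^ 3 * (real n)\<^sup>2"
      using H uniform_sparse_hypergraph(2)[OF H(1) _ H(2,4)] assms by (simp_all add: num_edges_def)
    have n_pos: "0 < real n" using n1 by simp
    note err = error_terms_le[OF n_pos T(1) T_pow p(1) pT K assms(3,2) E refl refl T(2)]
    have "0 < a * (real n)\<^sup>2" using assms n_pos by simp
    then have E_pos: "0 < real (card (hedges H))" using E by linarith
    then have E_ne: "hedges H \<noteq> {}" by auto
    have \<mu>_eq: "\<mu> = card (hedges H) * p ^ k"
      using mean_edges_eq[OF H(1)] p err(1) by (simp add: \<mu> num_edges_def)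
    then have \<mu>_pos: "0 < \<mu>" using E_pos p by simp
    have "\<mu> \<le> D ^ 3 * (real n)\<^sup>2 * p ^ k"
      unfolding \<mu>_eq using E p by (intro mult_right_mono) auto
    also have "\<dots> = D ^ 3 * ((real n)\<^sup>2 * p ^ k)" by simp
    also have "\<dots> \<le> D ^ 3 * T"
      using mean_le[OF k_ge_3 n_pos _ T_pow p(1) pT] T assms by (intro mult_left_mono) auto
    finally have \<mu>_le: "\<mu> \<le> D ^ 3 * T" .
    \<comment> \<open>The exponents compare because \<open>3 * k + 1 <= 4 * k\<close>.\<close>
    have "real n powr (1 / (2 * real k)) \<le> T"
      unfolding T_def x_def using n1 k_ge_3 by (intro powr_mono) (auto simp: field_simps)
    also have "T \<le> D ^ 3 * T" using D3 T by simp
    finally have s_le: "s \<le> 9 * (D ^ 3 * T)" using t \<mu>_le by (simp add: s_def)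
    have s: "1 \<le> s" "sqrt s \<le> s"
      using t real_sqrt_le_mono[of s "s\<^sup>2"] by (auto simp: s_def power2_eq_square)
    have N_le: "real m \<le> K * T" if "m \<in> N" for m
      using that s s_le by (simp add: N_def K_def)
    have "N \<subseteq> {..nat \<lceil>K * T\<rceil>}" using N_le by (fastforce simp: le_nat_iff le_ceiling_iff)
    then have finN: "finite N" by (rule finite_subset) simp
    have "d * exp (- 9 * phi (t / \<mu>) * \<mu>) \<le> exp (- C) * (\<Sum>m\<in>N. exp (- \<mu>) * \<mu> ^ m / fact m)"
      unfolding d_def N_def s_def mult.assoc[of "exp (- C)"]
      by (intro mult_left_mono poisson_tail_ge[OF \<mu>_pos t(1,2)]) simp
    also have "\<dots> \<le> subset_expectation (hverts H) p (\<lambda>W. of_bool (card {f \<in> hedges H. f \<subseteq> W} \<in> N))"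
    proof (rule order_trans[OF mult_right_mono])
      show "exp (- C) \<le> exp (- (real (card (hedges H)) * (2 * p ^ (2 * k))
          + real k * (K * T) * (D\<^sup>2 * real n) * (2 * p ^ (k - 1))
          + (real k * (K * T))\<^sup>2 * D * (2 * p)
          + 2 * (K * T) * blocking_bound (K * T) / card (hedges H)))"
        using err(3) by (simp add: C_def)
      show "0 \<le> (\<Sum>m\<in>N. exp (- \<mu>) * \<mu> ^ m / fact m)"
        using \<mu>_pos by (intro sum_nonneg) auto
      show "exp (- (real (card (hedges H)) * (2 * p ^ (2 * k))
          + real k * (K * T) * (D\<^sup>2 * real n) * (2 * p ^ (k - 1))
          + (real k * (K * T))\<^sup>2 * D * (2 * p)
          + 2 * (K * T) * blocking_bound (K * T) / card (hedges H)))
          * (\<Sum>m\<in>N. exp (- \<mu>) * \<mu> ^ m / fact m)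
          \<le> subset_expectation (hverts H) p (\<lambda>W. of_bool (card {f \<in> hedges H. f \<subseteq> W} \<in> N))"
        unfolding \<mu>_eq using p err(1,2) finN N_le K T E_ne by (intro prob_card_edges_ge) auto
    qed
    also have "\<dots> \<le> subset_expectation (hverts H) p
        (\<lambda>W. of_bool (s \<le> real (card {f \<in> hedges H. f \<subseteq> W})))"
      using p err(1) by (intro subset_expectation_mono) (auto simp: N_def)
    also have "\<dots> = measure_pmf.prob (random_induced H p) {G. real (num_edges G) \<ge> \<mu> + t}"
      using prob_num_edges_eq[OF finite_verts, of p "\<lambda>m. s \<le> real m"] p err(1) by (simp add: s_def)
    finally have prob: "d * exp (- 9 * phi (t / \<mu>) * \<mu>)
        \<le> measure_pmf.prob (random_induced H p) {G. real (num_edges G) \<ge> \<mu> + t}" .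
    \<comment> \<open>The second inequality of the theorem, with the same constant 9, is just
      \<open>phi x <= x\<^sup>2\<close>.\<close>
    have "phi (t / \<mu>) * \<mu> \<le> (t / \<mu>)\<^sup>2 * \<mu>"
      using t \<mu>_pos by (intro mult_right_mono phi_le_square) auto
    also have "\<dots> = t\<^sup>2 / \<mu>" by (simp add: power2_eq_square)
    finally have "d * exp (- 9 * t\<^sup>2 / \<mu>) \<le> d * exp (- 9 * phi (t / \<mu>) * \<mu>)"
      using d by simp
    with prob show ?thesis by blast
  qed
  show ?thesis
  proof (rule exI[of _ n0], rule exI[of _ "9::real"], rule exI[of _ d], intro conjI allI impI)
    fix n :: nat and H :: "'a hypergraph" and p t :: real
    assume asm: "n \<ge> n0" "uniform_hypergraph k H" "real (num_verts H) \<le> D * real n"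
      "real (num_edges H) \<ge> a * (real n)\<^sup>2" "real (Delta2 H) \<le> D"
      "0 < p" "p \<le> real n powr (- 2 / (real k + 1 / 3))" "0 \<le> t"
    show "let \<mu> = mean_edges H p in 1 \<le> \<mu> + t \<longrightarrow>
        \<mu> + t \<le> 9 * max \<mu> (real n powr (1 / (2 * real k))) \<longrightarrow>
        measure_pmf.prob (random_induced H p) {G. real (num_edges G) \<ge> \<mu> + t}
          \<ge> d * exp (- 9 * phi (t / \<mu>) * \<mu>) \<and>
        d * exp (- 9 * phi (t / \<mu>) * \<mu>) \<ge> d * exp (- 9 * t^2 / \<mu>)"
      unfolding Let_def by (intro impI) (rule main[OF asm _ _ refl])
  qed (use n0(1) d in simp_all)
qed

end
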